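(* Let $K$ be a finite field, let $A_1,\ldots,A_s$ be subgroups of the multiplicative group $K^*$, let $T=A_1\times\cdots\times A_s\subset K^s$, let $I\subset S=K[t_1,\ldots,t_s]$ be the vanishing ideal of $T$, let $\prec$ be a graded monomial order on $S$, and put $d_i=|A_i|$ for $i=1,\ldots,s$. Let $\mathcal{L}$ be a linear subspace of $S$ with a basis of standard monomials $\mathcal{A}=\{t^{a_1},\ldots,t^{a_k}\}\subset\Delta_\prec(I)$, where $t^{a_i}=t_1^{a_{i,1}}\cdots t_s^{a_{i,s}}$. For each $i$ put $t^{b_i}=1$ if $t^{a_i}=1$, and $$t^{b_i}=\prod_{t_j\in\mathrm{supp}(t^{a_i})}t_j^{d_j-a_{i,j}}\quad\text{if } t^{a_i}\neq 1,$$ and let $\mathcal{B}=\{t^{b_1},\ldots,t^{b_k}\}$. Then $\mathcal{L}^\perp=K(\Delta_\prec(I)\setminus\mathcal{B})$.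
   Context: Write $T=\{P_1,\ldots,P_m\}$. The vanishing ideal $I$ of $T$ is the ideal of all polynomials vanishing on $T$. $\Delta_\prec(I)$ is the set of standard monomials of $S/I$ (monomials not in $\mathrm{in}_\prec(I)$); here it consists of all $t_1^{c_1}\cdots t_s^{c_s}$ with $0\le c_i\le d_i-1$ for all $i$. $K\mathcal{M}$ denotes the $K$-span in $S$ of a set $\mathcal{M}$. The support $\mathrm{supp}(t^{a_i})$ is the set of all variables $t_j$ with $a_{i,j}>0$. The algebraic dual of a finite-dimensional linear subspace $\mathcal{L}\subset S$ is $\mathcal{L}^\perp=\{g\in K\Delta_\prec(I): \varphi(gf)=0\text{ for all }f\in\mathcal{L}\}$, where $\varphi\colon S\to K$ is $\varphi(f)=f(P_1)+\cdots+f(P_m)$. *)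

theory Defs
  imports Complex_Main "HOL-Library.Poly_Mapping"
begin

text \<open>The ring \<open>K[t\<^sub>1, \<dots>, t\<^sub>s]\<close> is \<open>('n, 'a) mpoly\<close>, where the finite type \<open>'n\<close> indexes the variables
  (\<open>s = CARD('n)\<close>); an exponent vector \<open>(c\<^sub>1, \<dots>, c\<^sub>s)\<close> is an element of \<open>'n \<Rightarrow>\<^sub>0 nat\<close>. The ring
  structure (convolution product) is that of \<open>HOL-Library.Poly_Mapping\<close>. Points of \<open>K\<^sup>s\<close> are
  functions \<open>'n \<Rightarrow> 'a\<close>.\<close>

type_synonym 'n expo = "'n \<Rightarrow>\<^sub>0 nat"
type_synonym ('n, 'a) mpoly = "('n \<Rightarrow>\<^sub>0 nat) \<Rightarrow>\<^sub>0 'a"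

definition monom :: "'n expo \<Rightarrow> ('n, 'a::field) mpoly"
  where "monom c = Poly_Mapping.single c 1"

definition var :: "'n \<Rightarrow> ('n, 'a::field) mpoly"
  where "var j = monom (Poly_Mapping.single j 1)"

definition scale :: "'a::field \<Rightarrow> ('n, 'a) mpoly \<Rightarrow> ('n, 'a) mpoly"
  where "scale k f = Poly_Mapping.single 0 k * f"

global_interpretation poly_space: vector_space "scale :: 'a::field \<Rightarrow> ('n, 'a) mpoly \<Rightarrow> ('n, 'a) mpoly"
  by unfold_locales
    (simp_all add: scale_def algebra_simps single_add mult_single flip: mult.assoc)

text \<open>The polynomial ring as a module over itself: \<open>poly_ring.span G\<close> is the ideal generated by \<open>G\<close>.\<close>

global_interpretation poly_ring: module "(*) :: ('n, 'a::field) mpoly \<Rightarrow> ('n, 'a) mpoly \<Rightarrow> ('n, 'a) mpoly"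
  by unfold_locales (simp_all add: algebra_simps)

definition eval_at :: "('n::finite \<Rightarrow> 'a::field) \<Rightarrow> ('n, 'a) mpoly \<Rightarrow> 'a"
  where "eval_at P f =
    (\<Sum>c\<in>Poly_Mapping.keys f. Poly_Mapping.lookup f c * (\<Prod>j\<in>UNIV. P j ^ Poly_Mapping.lookup c j))"

lemma eval_at_monom [simp]:
  "eval_at P (monom c) = (\<Prod>j\<in>UNIV. P j ^ Poly_Mapping.lookup c j)"
  by (simp add: eval_at_def monom_def)

definition vanishing_ideal :: "('n::finite \<Rightarrow> 'a::field) set \<Rightarrow> ('n, 'a) mpoly set"
  where "vanishing_ideal T = {f. \<forall>P\<in>T. eval_at P f = 0}"

definition mult_subgroup :: "'a::field set \<Rightarrow> bool"
  where "mult_subgroup H \<longleftrightarrow>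
    0 \<notin> H \<and> 1 \<in> H \<and> (\<forall>x\<in>H. \<forall>y\<in>H. x * y \<in> H) \<and> (\<forall>x\<in>H. inverse x \<in> H)"

definition total_degree :: "'n::finite expo \<Rightarrow> nat"
  where "total_degree c = (\<Sum>j\<in>UNIV. Poly_Mapping.lookup c j)"

text \<open>Monomial orders are strict orders on exponent vectors. That they are well-orders follows from
  the conditions below by Dickson's lemma.\<close>

definition monomial_order :: "('n expo \<Rightarrow> 'n expo \<Rightarrow> bool) \<Rightarrow> bool"
  where "monomial_order prec \<longleftrightarrow>
    irreflp prec \<and> transp prec \<and> totalp prec \<and>
    (\<forall>c. c \<noteq> 0 \<longrightarrow> prec 0 c) \<and>
    (\<forall>b c e. prec b c \<longrightarrow> prec (b + e) (c + e))"

definition graded_monomial_order :: "('n::finite expo \<Rightarrow> 'n expo \<Rightarrow> bool) \<Rightarrow> bool"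
  where "graded_monomial_order prec \<longleftrightarrow>
    monomial_order prec \<and> (\<forall>b c. total_degree b < total_degree c \<longrightarrow> prec b c)"

definition initial_exponent :: "('n expo \<Rightarrow> 'n expo \<Rightarrow> bool) \<Rightarrow> ('n, 'a::field) mpoly \<Rightarrow> 'n expo"
  where "initial_exponent prec f =
    (THE c. c \<in> Poly_Mapping.keys f \<and> (\<forall>b\<in>Poly_Mapping.keys f. b \<noteq> c \<longrightarrow> prec b c))"

definition initial_ideal ::
    "('n expo \<Rightarrow> 'n expo \<Rightarrow> bool) \<Rightarrow> ('n, 'a::field) mpoly set \<Rightarrow> ('n, 'a) mpoly set"
  where "initial_ideal prec I =
    poly_ring.span {monom (initial_exponent prec f) | f. f \<in> I \<and> f \<noteq> 0}"

definition standard_monomials ::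
    "('n expo \<Rightarrow> 'n expo \<Rightarrow> bool) \<Rightarrow> ('n, 'a::field) mpoly set \<Rightarrow> ('n, 'a) mpoly set"
  where "standard_monomials prec I = {monom c | c. monom c \<notin> initial_ideal prec I}"

definition eval_sum :: "('n::finite \<Rightarrow> 'a::field) set \<Rightarrow> ('n, 'a) mpoly \<Rightarrow> 'a"
  where "eval_sum T f = (\<Sum>P\<in>T. eval_at P f)"

definition algebraic_dual ::
    "('n::finite expo \<Rightarrow> 'n expo \<Rightarrow> bool) \<Rightarrow> ('n \<Rightarrow> 'a::field) set \<Rightarrow> ('n, 'a) mpoly set \<Rightarrow> ('n, 'a) mpoly set"
  where "algebraic_dual prec T L =
    {g \<in> poly_space.span (standard_monomials prec (vanishing_ideal T)).
       \<forall>f\<in>L. eval_sum T (g * f) = 0}"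

text \<open>The monomial \<open>t\<^sup>b\<close> attached to \<open>t\<^sup>a\<close>. If \<open>t\<^sup>a\<close> is standard then \<open>a\<^sub>j < d\<^sub>j\<close>, so the subtraction
  on \<open>nat\<close> does not truncate. The support of \<open>t\<^sup>a\<close> is \<open>keys a\<close>.\<close>

definition complementary_monomial :: "('n \<Rightarrow> nat) \<Rightarrow> 'n expo \<Rightarrow> ('n, 'a::field) mpoly"
  where "complementary_monomial d a =
    (if a = 0 then 1
     else (\<Prod>j\<in>Poly_Mapping.keys a. var j ^ (d j - Poly_Mapping.lookup a j)))"

end

theory Submission
  imports "HOL-Computational_Algebra.Polynomial" "HOL-Library.FuncSet" Defs
begin

text \<open>
  Write \<open>\<phi>\<close> for the functional that sums a polynomial over the points of \<open>T\<close>. On a monomial it factors,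
  \<open>\<phi>(t\<^sup>c) = \<Prod>\<^sub>j \<Sum>\<^bsub>x \<in> A\<^sub>j\<^esub> x\<^bsup>c\<^sub>j\<^esup>\<close>, and each factor is a power sum over a finite subgroup of order
  \<open>d\<^sub>j\<close>, which is \<open>d\<^sub>j\<close> if \<open>d\<^sub>j\<close> divides \<open>c\<^sub>j\<close> and \<open>0\<close> otherwise. Since \<open>d\<^sub>j\<close> is invertible in the field,
  \<open>\<phi>(t\<^sup>c)\<close> is nonzero exactly when \<open>d\<^sub>j\<close> divides \<open>c\<^sub>j\<close> for all \<open>j\<close> (\<open>eval_sum_monom_neq_0_iff\<close>).

  Hence, for exponents \<open>b\<close> and \<open>a\<close> in the box \<open>0 \<le> c\<^sub>j < d\<^sub>j\<close>, the value \<open>\<phi>(t\<^sup>b t\<^sup>a)\<close> is nonzero for one \<open>b\<close>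
  only, and this \<open>b\<close> is the exponent complementary to \<open>a\<close>. For \<open>g\<close> supported in the box, \<open>\<phi>(g t\<^sup>a)\<close> is
  therefore a nonzero multiple of a single coefficient of \<open>g\<close>, so \<open>g\<close> is orthogonal to \<open>\<L>\<close> if and only
  if the coefficient of \<open>g\<close> at each complementary monomial vanishes
  (\<open>eval_sum_mult_monom_eq_0_iff\<close>). That is the claim, once the box is known to consist of the
  standard exponents.

  The same functional identifies the standard monomials (\<open>standard_monomials_torus\<close>). A monomial
  with exponent outside the box is a multiple of the leading monomial of some \<open>t\<^sub>j\<^bsup>d\<^sub>j\<^esup> - 1\<close>. Conversely, suppose that the
  leading exponent \<open>c\<close> of some \<open>f \<in> I\<close> lies in the box. If \<open>b \<noteq> c\<close> is congruent to \<open>c\<close> modulo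
  \<open>(d\<^sub>1, \<dots>, d\<^sub>s)\<close>, then \<open>t\<^sup>b\<close> is a proper multiple of \<open>t\<^sup>c\<close>, hence larger, and does not occur in \<open>f\<close>. Pairing \<open>f\<close>
  with a monomial that singles out this residue class then gives a nonzero multiple of the leading
  coefficient, although \<open>\<phi>\<close> vanishes on \<open>I\<close>.
\<close>

hide_const (open) Polynomial.monom

section \<open>Power sums over a finite multiplicative subgroup\<close>

lemma mult_subgroup_bij_mult:
  fixes H :: "'a::field set"
  assumes H: "mult_subgroup H" and y: "y \<in> H"
  shows "bij_betw ((*) y) H H"
proof (rule bij_betwI[where g = "(*) (inverse y)"])
  have "y \<noteq> 0" using assms by (auto simp: mult_subgroup_def)
  then show "inverse y * (y * x) = x" "y * (inverse y * x) = x" for x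
    by (simp_all add: field_simps)
qed (use assms in \<open>auto simp: mult_subgroup_def\<close>)

text \<open>Lagrange's theorem for a commutative group: multiplication by \<open>y\<close> permutes \<open>H\<close>, so the product of
  all elements of \<open>H\<close> does not change when each of them is multiplied by \<open>y\<close>.\<close>

lemma mult_subgroup_power_card:
  fixes H :: "'a::field set"
  assumes H: "mult_subgroup H" and fin: "finite H" and y: "y \<in> H"
  shows "y ^ card H = 1"
proof -
  have "\<Prod>H = (\<Prod>x\<in>H. y * x)"
    using prod.reindex_bij_betw[OF mult_subgroup_bij_mult[OF H y], of "\<lambda>x. x"] by simp
  also have "\<dots> = y ^ card H * \<Prod>H"
    by (simp add: prod.distrib)
  finally have "\<Prod>H = y ^ card H * \<Prod>H" .
  moreover have "\<Prod>H \<noteq> 0"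
    using fin H by (auto simp: mult_subgroup_def)
  ultimately show ?thesis by simp
qed

text \<open>The elements of \<open>H\<close> are roots of \<open>X\<^sup>n - 1\<close>.\<close>

lemma card_le_exponent:
  fixes H :: "'a::field set"
  assumes "n > 0" and "\<And>x. x \<in> H \<Longrightarrow> x ^ n = 1"
  shows "card H \<le> n"
proof -
  define p :: "'a poly" where "p = Polynomial.monom 1 n - 1"
  have coeff: "coeff p n = 1"
    using \<open>n > 0\<close> by (simp add: p_def)
  then have "p \<noteq> 0" by auto
  moreover have "degree p \<le> n"
    unfolding p_def by (intro degree_diff_le degree_monom_le) simp
  moreover have "H \<subseteq> {x. poly p x = 0}"
    using assms by (auto simp: p_def poly_monom)
  ultimately show ?thesis
    using card_mono[OF poly_roots_finite, of p H] card_poly_roots_bound[of p] by simp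
qed

text \<open>Some \<open>y \<in> H\<close> has \<open>y\<^sup>n \<noteq> 1\<close>, for otherwise the remainder of \<open>n\<close> modulo \<open>card H\<close> would be a positive
  exponent of \<open>H\<close> smaller than its order. Substituting \<open>y x\<close> for \<open>x\<close> multiplies the power sum by \<open>y\<^sup>n\<close>
  and leaves it unchanged.\<close>

lemma power_sum_eq_0:
  fixes H :: "'a::field set"
  assumes H: "mult_subgroup H" and fin: "finite H" and ndvd: "\<not> card H dvd n"
  shows "(\<Sum>x\<in>H. x ^ n) = 0"
proof -
  obtain y where y: "y \<in> H" "y ^ n \<noteq> 1"
  proof -
    have pos: "card H > 0" using fin H by (auto simp: card_gt_0_iff mult_subgroup_def)
    have "\<not> card H \<le> n mod card H" using pos by (simp add: not_le)
    then obtain y where "y \<in> H" "y ^ (n mod card H) \<noteq> 1"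
      using card_le_exponent[of "n mod card H" H] ndvd by (auto simp: dvd_eq_mod_eq_0)
    moreover have "y ^ n = (y ^ card H) ^ (n div card H) * y ^ (n mod card H)"
      by (metis div_mult_mod_eq mult.commute power_add power_mult)
    ultimately show ?thesis
      using that mult_subgroup_power_card[OF H fin] by auto
  qed
  have "(\<Sum>x\<in>H. x ^ n) = (\<Sum>x\<in>H. (y * x) ^ n)"
    using sum.reindex_bij_betw[OF mult_subgroup_bij_mult[OF H y(1)], of "\<lambda>x. x ^ n"] by simp
  also have "\<dots> = y ^ n * (\<Sum>x\<in>H. x ^ n)"
    by (simp add: power_mult_distrib sum_distrib_left)
  finally show ?thesis using y(2) by simp
qed

lemma power_sum_eq_card:
  fixes H :: "'a::field set"
  assumes "mult_subgroup H" "finite H" "card H dvd n"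
  shows "(\<Sum>x\<in>H. x ^ n) = of_nat (card H)"
proof -
  have "x ^ n = 1" if "x \<in> H" for x
    using assms mult_subgroup_power_card[OF assms(1,2) that] by (auto simp: dvd_def power_mult)
  then show ?thesis by simp
qed

text \<open>The characteristic does not divide the order of \<open>H\<close>. If it did, the power sums over \<open>H\<close> would vanish
  for all exponents below \<open>card H\<close>, that for \<open>0\<close> included, and so would the sum over \<open>H\<close> of the values
  of any polynomial of degree below \<open>card H\<close>. The Lagrange polynomial that is nonzero on \<open>H\<close> only at
  \<open>1\<close> shows that this is impossible.\<close>

lemma of_nat_card_mult_subgroup_neq_0:
  fixes H :: "'a::field set"
  assumes H: "mult_subgroup H" and fin: "finite H"
  shows "of_nat (card H) \<noteq> (0::'a)"
proof
  assume zero: "of_nat (card H) = (0::'a)"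
  define p where "p = (\<Prod>y\<in>H - {1}. [:- y, 1:])"
  have one: "1 \<in> H" using H by (simp add: mult_subgroup_def)
  have "degree p = card (H - {1})"
    unfolding p_def by (subst degree_prod_sum_eq) auto
  then have deg: "degree p < card H"
    using one fin by (metis card_Diff1_less)
  have "(\<Sum>x\<in>H. poly p x) = (\<Sum>x\<in>H. \<Sum>i\<le>degree p. coeff p i * x ^ i)"
    by (simp add: poly_altdef)
  also have "\<dots> = (\<Sum>i\<le>degree p. coeff p i * (\<Sum>x\<in>H. x ^ i))"
    by (subst sum.swap) (simp add: sum_distrib_left)
  also have "\<dots> = 0"
  proof (intro sum.neutral ballI)
    fix i assume "i \<in> {..degree p}"
    then have "i = 0 \<or> \<not> card H dvd i"
      using deg by (auto dest: dvd_imp_le)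
    then show "coeff p i * (\<Sum>x\<in>H. x ^ i) = 0"
      using zero power_sum_eq_0[OF H fin] by auto
  qed
  finally have "(\<Sum>x\<in>H. poly p x) = 0" .
  moreover have "(\<Sum>x\<in>H. poly p x) = poly p 1 + (\<Sum>x\<in>H - {1}. poly p x)"
    using one fin by (simp add: sum.remove)
  moreover have "(\<Sum>x\<in>H - {1}. poly p x) = 0"
    using fin by (intro sum.neutral) (auto simp: p_def poly_prod)
  moreover have "poly p 1 \<noteq> 0"
    using fin by (auto simp: p_def poly_prod)
  ultimately show False by simp
qed

section \<open>Evaluation and spans of monomials\<close>

lemma eval_at_superset:
  assumes "finite S" "Poly_Mapping.keys f \<subseteq> S"
  shows "eval_at P f =
    (\<Sum>c\<in>S. Poly_Mapping.lookup f c * (\<Prod>j\<in>UNIV. P j ^ Poly_Mapping.lookup c j))"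
  unfolding eval_at_def using assms
  by (intro sum.mono_neutral_left) (auto simp: in_keys_iff)

lemma eval_at_add: "eval_at P (f + g) = eval_at P f + eval_at P g"
proof -
  let ?S = "Poly_Mapping.keys f \<union> Poly_Mapping.keys g"
  have "Poly_Mapping.keys (f + g) \<subseteq> ?S" by (rule Poly_Mapping.keys_add)
  then show ?thesis
    by (simp add: eval_at_superset[of ?S] lookup_add distrib_right sum.distrib)
qed

lemma eval_at_zero [simp]: "eval_at P 0 = 0"
  by (simp add: eval_at_def)

lemma eval_at_sum: "eval_at P (\<Sum>i\<in>S. f i) = (\<Sum>i\<in>S. eval_at P (f i))"
  by (induction S rule: infinite_finite_induct) (auto simp: eval_at_add)

lemma eval_at_single [simp]:
  "eval_at P (Poly_Mapping.single c k) = k * (\<Prod>j\<in>UNIV. P j ^ Poly_Mapping.lookup c j)"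
  by (simp add: eval_at_def)

lemma mpoly_eq_sum_single:
  "f = (\<Sum>c\<in>Poly_Mapping.keys f. Poly_Mapping.single c (Poly_Mapping.lookup f c))"
  by (rule poly_mapping_eqI) (auto simp: lookup_sum lookup_single when_def in_keys_iff)

lemma eval_at_mult: "eval_at P (f * g) = eval_at P f * eval_at P g"
proof -
  have "eval_at P (f * g) =
      (\<Sum>b\<in>Poly_Mapping.keys f. \<Sum>c\<in>Poly_Mapping.keys g.
         eval_at P (Poly_Mapping.single b (Poly_Mapping.lookup f b) *
           Poly_Mapping.single c (Poly_Mapping.lookup g c)))"
    by (subst (1) mpoly_eq_sum_single[of f], subst (1) mpoly_eq_sum_single[of g])
      (simp add: sum_product eval_at_sum)
  also have "\<dots> = eval_at P f * eval_at P g"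
    by (simp add: mult_single lookup_add power_add prod.distrib eval_at_def[of P f] eval_at_def[of P g]
        sum_product ac_simps)
  finally show ?thesis .
qed

lemma scale_single [simp]:
  "scale k (Poly_Mapping.single c l) = Poly_Mapping.single c (k * l)"
  by (simp add: scale_def mult_single)

lemma lookup_scale [simp]: "Poly_Mapping.lookup (scale k f) c = k * Poly_Mapping.lookup f c"
  by (simp add: scale_def Poly_Mapping.map.rep_eq when_def flip: mult_map_scale_conv_mult)

lemma inj_monom: "inj (monom :: 'n expo \<Rightarrow> ('n, 'a::field) mpoly)"
proof (rule injI)
  fix b c :: "'n expo" assume "(monom b :: ('n, 'a) mpoly) = monom c"
  then have "Poly_Mapping.keys (monom b :: ('n, 'a) mpoly) = Poly_Mapping.keys (monom c :: ('n, 'a) mpoly)"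
    by simp
  then show "b = c" by (simp add: monom_def)
qed

text \<open>Spans of monomials are described by supports. This turns membership in the span, both in the
  definition of the dual and in the claim, into a condition on exponents.\<close>

lemma span_monom:
  "poly_space.span (monom ` C) = {f :: ('n, 'a::field) mpoly. Poly_Mapping.keys f \<subseteq> C}"
proof (rule poly_space.span_unique)
  show "monom ` C \<subseteq> {f :: ('n, 'a) mpoly. Poly_Mapping.keys f \<subseteq> C}"
    by (auto simp: monom_def)
  show "poly_space.subspace {f :: ('n, 'a) mpoly. Poly_Mapping.keys f \<subseteq> C}"
    by (rule poly_space.subspaceI) (auto simp: in_keys_iff subset_iff lookup_add, metis add_0)
  fix S :: "('n, 'a) mpoly set"
  assume sub: "monom ` C \<subseteq> S" "poly_space.subspace S"
  show "{f. Poly_Mapping.keys f \<subseteq> C} \<subseteq> S"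
  proof
    fix f :: "('n, 'a) mpoly" assume "f \<in> {f. Poly_Mapping.keys f \<subseteq> C}"
    then have "(\<Sum>c\<in>Poly_Mapping.keys f. scale (Poly_Mapping.lookup f c) (monom c)) \<in> S"
      using sub by (intro poly_space.subspace_sum poly_space.subspace_scale) auto
    then show "f \<in> S"
      using mpoly_eq_sum_single[of f] by (simp add: monom_def)
  qed
qed

section \<open>The functional summing over the points of the torus\<close>

lemma eval_sum_mult_monom:
  "eval_sum T (f * monom e) =
    (\<Sum>c\<in>Poly_Mapping.keys f. Poly_Mapping.lookup f c * eval_sum T (monom (c + e)))"
proof -
  have "eval_sum T (f * monom e) = (\<Sum>P\<in>T. \<Sum>c\<in>Poly_Mapping.keys f.
      Poly_Mapping.lookup f c * eval_at P (monom (c + e)))"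
    unfolding eval_sum_def
    by (simp add: eval_at_mult)
      (simp add: eval_at_def lookup_add power_add prod.distrib sum_distrib_right mult.assoc)
  also have "\<dots> = (\<Sum>c\<in>Poly_Mapping.keys f. Poly_Mapping.lookup f c * eval_sum T (monom (c + e)))"
    by (subst sum.swap) (simp add: eval_sum_def sum_distrib_left)
  finally show ?thesis .
qed

text \<open>The points of the torus are the choice functions of the family \<open>A\<close>, so summing a product over them
  is distributivity.\<close>

lemma eval_sum_monom_eq_prod:
  fixes A :: "'n::finite \<Rightarrow> 'a::{field, finite} set"
  shows "eval_sum {P. \<forall>i. P i \<in> A i} (monom c) = (\<Prod>j\<in>UNIV. \<Sum>x\<in>A j. x ^ Poly_Mapping.lookup c j)"
proof -
  have "{P. \<forall>i. P i \<in> A i} = PiE UNIV A" by (auto simp: PiE_def Pi_def)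
  then show ?thesis
    unfolding eval_sum_def by (simp add: prod_sum_PiE)
qed

lemma eval_sum_monom_neq_0_iff:
  fixes A :: "'n::finite \<Rightarrow> 'a::{field, finite} set"
  assumes A: "\<forall>i. mult_subgroup (A i)"
  shows "eval_sum {P. \<forall>i. P i \<in> A i} (monom c) \<noteq> 0 \<longleftrightarrow>
    (\<forall>j. card (A j) dvd Poly_Mapping.lookup c j)"
proof -
  have "(\<Sum>x\<in>A j. x ^ Poly_Mapping.lookup c j) \<noteq> 0 \<longleftrightarrow> card (A j) dvd Poly_Mapping.lookup c j" for j
    using power_sum_eq_0[OF A[rule_format, of j]] power_sum_eq_card[OF A[rule_format, of j]]
      of_nat_card_mult_subgroup_neq_0[OF A[rule_format, of j]] by auto
  then show ?thesis
    by (simp add: eval_sum_monom_eq_prod)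
qed

section \<open>The standard monomials of the torus\<close>

definition exponent_box :: "('n \<Rightarrow> nat) \<Rightarrow> 'n expo set"
  where "exponent_box d = {c. \<forall>j. Poly_Mapping.lookup c j < d j}"

lemma initial_exponent_greatest:
  assumes mo: "monomial_order prec" and "f \<noteq> 0"
  shows "initial_exponent prec f \<in> Poly_Mapping.keys f \<and>
    (\<forall>b\<in>Poly_Mapping.keys f. b \<noteq> initial_exponent prec f \<longrightarrow> prec b (initial_exponent prec f))"
  unfolding initial_exponent_def
proof (rule theI')
  have ord: "irreflp prec" "transp prec" "totalp prec" using mo by (auto simp: monomial_order_def)
  have "\<exists>c\<in>Poly_Mapping.keys f. \<forall>b\<in>Poly_Mapping.keys f. b \<noteq> c \<longrightarrow> prec b c"
    using ord \<open>f \<noteq> 0\<close>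
    by (intro Finite_Set.bex_greatest_element)
      (auto intro: transp_on_subset totalp_on_subset)
  then show "\<exists>!c. c \<in> Poly_Mapping.keys f \<and> (\<forall>b\<in>Poly_Mapping.keys f. b \<noteq> c \<longrightarrow> prec b c)"
    using ord by (metis irreflpD transpD)
qed

text \<open>A monomial in a monomial ideal is a multiple of one of the generating monomials, because the polynomials all of whose
  exponents are such multiples form an ideal.\<close>

lemma monom_in_span_monomsD:
  assumes "(monom c :: ('n, 'a::field) mpoly) \<in> poly_ring.span (monom ` E)"
  shows "\<exists>e\<in>E. \<exists>b. c = b + e"
proof -
  let ?S = "{f :: ('n, 'a) mpoly. \<forall>c\<in>Poly_Mapping.keys f. \<exists>e\<in>E. \<exists>b. c = b + e}"
  have "poly_ring.span (monom ` E) \<subseteq> ?S"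
  proof (rule poly_ring.span_minimal)
    show "monom ` E \<subseteq> ?S" by (auto simp: monom_def) (metis add_0)
    show "poly_ring.subspace ?S"
    proof (rule poly_ring.subspaceI)
      fix f g assume "f \<in> ?S" "g \<in> ?S"
      then show "f + g \<in> ?S" using Poly_Mapping.keys_add[of f g] by blast
    next
      fix f g assume g: "g \<in> ?S"
      show "f * g \<in> ?S"
      proof (clarify)
        fix c assume "c \<in> Poly_Mapping.keys (f * g)"
        then obtain b c' where "c = b + c'" "c' \<in> Poly_Mapping.keys g"
          using keys_mult[of f g] by blast
        moreover from this g obtain e b' where "e \<in> E" "c' = b' + e" by blast
        ultimately show "\<exists>e\<in>E. \<exists>b. c = b + e" by (metis add.assoc)
      qed
    qed simp
  qed
  with assms have "monom c \<in> ?S" by blast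
  then show ?thesis by (simp add: monom_def)
qed

text \<open>Among the exponents congruent to a leading exponent \<open>c\<close> in the box, \<open>c\<close> is the only one that can
  occur in \<open>f\<close>: the others exceed \<open>c\<close> in some coordinates and nowhere fall below it, hence are larger. Summing
  \<open>f t\<^sup>e\<close> over the torus, with \<open>e\<close> opposite to \<open>c\<close>, thus isolates the leading coefficient of \<open>f\<close>.\<close>

lemma initial_exponent_not_in_box:
  fixes A :: "'n::finite \<Rightarrow> 'a::{field, finite} set"
  assumes A: "\<forall>i. mult_subgroup (A i)" and mo: "monomial_order prec"
    and f: "f \<in> vanishing_ideal {P. \<forall>i. P i \<in> A i}" "f \<noteq> 0"
  shows "initial_exponent prec f \<notin> exponent_box (\<lambda>j. card (A j))"
proof
  define c where "c = initial_exponent prec f"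
  define T where "T = {P :: 'n \<Rightarrow> 'a. \<forall>i. P i \<in> A i}"
  \<comment> \<open>If \<open>c\<^sub>j = 0\<close> then \<open>e\<^sub>j = d\<^sub>j\<close> rather than \<open>0\<close>: here only \<open>c + e \<equiv> 0\<close> modulo \<open>d\<close> matters, and \<open>e\<close>
    may leave the box.\<close>
  define e where "e = Abs_poly_mapping (\<lambda>j. card (A j) - Poly_Mapping.lookup c j)"
  assume "initial_exponent prec f \<in> exponent_box (\<lambda>j. card (A j))"
  then have box: "Poly_Mapping.lookup c j < card (A j)" for j
    by (auto simp: c_def exponent_box_def)
  have e: "Poly_Mapping.lookup e j = card (A j) - Poly_Mapping.lookup c j" for j
    by (simp add: e_def)
  have c: "c \<in> Poly_Mapping.keys f" "\<And>b. b \<in> Poly_Mapping.keys f \<Longrightarrow> b \<noteq> c \<Longrightarrow> prec b c"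
    using initial_exponent_greatest[OF mo f(2)] by (auto simp: c_def)
  have other: "eval_sum T (monom (b + e)) = 0" if b: "b \<in> Poly_Mapping.keys f" "b \<noteq> c" for b
  proof (rule ccontr)
    assume "eval_sum T (monom (b + e)) \<noteq> 0"
    then have dvd: "card (A j) dvd Poly_Mapping.lookup b j + (card (A j) - Poly_Mapping.lookup c j)" for j
      using eval_sum_monom_neq_0_iff[OF A, of "b + e"] by (simp add: T_def lookup_add e)
    \<comment> \<open>A positive multiple of \<open>d\<^sub>j\<close> is at least \<open>d\<^sub>j\<close>, and \<open>e\<^sub>j\<close> is positive because \<open>c\<close> is in the box.\<close>
    have le: "Poly_Mapping.lookup c j \<le> Poly_Mapping.lookup b j" for j
      using dvd_imp_le[OF dvd[of j]] box[of j] by linarith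
    have "b = (b - c) + c"
      by (rule poly_mapping_eqI) (simp add: lookup_add lookup_minus le)
    moreover have "prec (0 + c) ((b - c) + c)"
    proof -
      have "b - c \<noteq> 0" using calculation b(2) by auto
      then show ?thesis using mo unfolding monomial_order_def by blast
    qed
    ultimately have "prec c b" by simp
    moreover have "prec b c" using c b by blast
    ultimately show False
      using mo unfolding monomial_order_def by (meson irreflpD transpD)
  qed
  have "eval_sum T (f * monom e) = Poly_Mapping.lookup f c * eval_sum T (monom (c + e))"
    unfolding eval_sum_mult_monom using c(1) other by (subst sum.remove[OF _ c(1)]) auto
  moreover have "eval_sum T (monom (c + e)) \<noteq> 0"
    using eval_sum_monom_neq_0_iff[OF A, of "c + e"] box
    by (simp add: T_def lookup_add e less_imp_le)
  moreover have "Poly_Mapping.lookup f c \<noteq> 0" using c(1) by (simp add: in_keys_iff)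
  moreover have "eval_sum T (f * monom e) = 0"
    using f(1) by (simp add: eval_sum_def eval_at_mult vanishing_ideal_def T_def del: eval_at_monom)
  ultimately show False by simp
qed

lemma standard_monomials_torus:
  fixes A :: "'n::finite \<Rightarrow> 'a::{field, finite} set"
  assumes A: "\<forall>i. mult_subgroup (A i)" and mo: "monomial_order prec"
  shows "standard_monomials prec (vanishing_ideal {P. \<forall>i. P i \<in> A i}) =
    monom ` exponent_box (\<lambda>j. card (A j))"
proof -
  define I where "I = vanishing_ideal {P. \<forall>i. P i \<in> A i}"
  have eq: "initial_ideal prec I =
      poly_ring.span (monom ` (initial_exponent prec ` {f \<in> I. f \<noteq> 0}))"
    unfolding initial_ideal_def by (rule arg_cong[of _ _ poly_ring.span]) auto
  have "monom c \<in> initial_ideal prec I \<longleftrightarrow> c \<notin> exponent_box (\<lambda>j. card (A j))" for c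
  proof
    assume "monom c \<in> initial_ideal prec I"
    then obtain f b where "f \<in> I" "f \<noteq> 0" "c = b + initial_exponent prec f"
      unfolding eq by (auto dest: monom_in_span_monomsD)
    moreover from this have "initial_exponent prec f \<notin> exponent_box (\<lambda>j. card (A j))"
      using initial_exponent_not_in_box[OF A mo] by (simp add: I_def)
    ultimately show "c \<notin> exponent_box (\<lambda>j. card (A j))"
      by (auto simp: exponent_box_def lookup_add not_less intro: trans_le_add2)
  next
    assume "c \<notin> exponent_box (\<lambda>j. card (A j))"
    then obtain j where j: "card (A j) \<le> Poly_Mapping.lookup c j"
      by (auto simp: exponent_box_def not_less)
    \<comment> \<open>The witness is \<open>f = t\<^sub>j\<^bsup>d\<^sub>j\<^esup> - 1\<close>, which vanishes on the torus and has leading exponent \<open>m\<close>.\<close>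
    define m where "m = Poly_Mapping.single j (card (A j))"
    define f :: "('n, 'a) mpoly" where "f = monom m - 1"
    have pos: "card (A j) > 0"
      using A[rule_format, of j] by (auto simp: card_gt_0_iff mult_subgroup_def)
    then have m: "m \<noteq> 0"
      unfolding m_def by (metis lookup_single_eq lookup_zero less_irrefl)
    have lookup: "Poly_Mapping.lookup f b = (if b = m then 1 else if b = 0 then -1 else 0)" for b
      using m by (auto simp: f_def monom_def lookup_minus lookup_single lookup_one when_def)
    have keys: "Poly_Mapping.keys f = {m, 0}"
      by (auto simp: in_keys_iff lookup split: if_splits)
    have "f \<noteq> 0" using keys by auto
    have "initial_exponent prec f = m"
      using initial_exponent_greatest[OF mo \<open>f \<noteq> 0\<close>] mo m unfolding keys monomial_order_def
      by (metis insert_iff irreflpD singletonD transpD)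
    moreover have "f \<in> I"
    proof -
      have "eval_at P f = 0" if "\<forall>i. P i \<in> A i" for P
      proof -
        have "P j ^ card (A j) = 1"
          using mult_subgroup_power_card[OF A[rule_format, of j]] that by simp
        moreover have "(\<Prod>i\<in>UNIV. P i ^ Poly_Mapping.lookup m i) = P j ^ card (A j)"
          by (subst prod.remove[of _ j]) (auto simp: m_def lookup_single when_def intro!: prod.neutral)
        ultimately show ?thesis
          using m by (simp add: eval_at_def keys lookup)
      qed
      then show ?thesis by (simp add: I_def vanishing_ideal_def)
    qed
    ultimately have "monom m \<in> initial_ideal prec I"
      unfolding eq using \<open>f \<noteq> 0\<close> by (intro poly_ring.span_base) force
    then have "monom (c - m) * monom m \<in> initial_ideal prec I"
      unfolding initial_ideal_def by (rule poly_ring.span_scale)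
    moreover have "(c - m) + m = c"
      by (rule poly_mapping_eqI) (use j in \<open>auto simp: m_def lookup_add lookup_minus lookup_single when_def\<close>)
    ultimately show "monom c \<in> initial_ideal prec I"
      by (simp add: monom_def mult_single)
  qed
  then show ?thesis
    unfolding I_def[symmetric] standard_monomials_def by auto
qed

section \<open>Complementary monomials and the dual\<close>

text \<open>The exponent of the complementary monomial. An exponent \<open>0\<close> is its own complement, so that the box
  is mapped to itself; in particular the complement of the monomial \<open>1\<close> is \<open>1\<close>.\<close>

definition complementary_exponent :: "('n::finite \<Rightarrow> nat) \<Rightarrow> 'n expo \<Rightarrow> 'n expo"
  where "complementary_exponent d c =
    Abs_poly_mapping (\<lambda>j. if Poly_Mapping.lookup c j = 0 then 0 else d j - Poly_Mapping.lookup c j)"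

lemma lookup_complementary_exponent:
  "Poly_Mapping.lookup (complementary_exponent d c) j =
    (if Poly_Mapping.lookup c j = 0 then 0 else d j - Poly_Mapping.lookup c j)"
  by (simp add: complementary_exponent_def)

lemma monom_add: "monom (b + c) = monom b * monom c"
  by (simp add: monom_def mult_single)

lemma var_power: "var j ^ n = monom (Poly_Mapping.single j n)"
proof (induction n)
  case 0
  show ?case by (simp add: monom_def)
next
  case (Suc n)
  then show ?case
    by (simp add: var_def flip: monom_add single_add)
qed

lemma prod_monom: "(\<Prod>i\<in>S. monom (f i)) = monom (\<Sum>i\<in>S. f i)"
  by (induction S rule: infinite_finite_induct) (auto simp: monom_add, simp_all add: monom_def)

lemma complementary_monomial_eq:
  "complementary_monomial d c = (monom (complementary_exponent d c) :: ('n::finite, 'a::field) mpoly)"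
proof -
  have "(\<Sum>j\<in>Poly_Mapping.keys c. Poly_Mapping.single j (d j - Poly_Mapping.lookup c j)) =
      complementary_exponent d c"
    by (rule poly_mapping_eqI)
      (auto simp: lookup_sum lookup_single when_def lookup_complementary_exponent in_keys_iff)
  moreover have "complementary_exponent d 0 = 0"
    by (rule poly_mapping_eqI) (simp add: lookup_complementary_exponent)
  ultimately show ?thesis
    by (auto simp: complementary_monomial_def var_power prod_monom) (simp add: monom_def)
qed

text \<open>The sum of two residues is below \<open>2 d\<close>, so it is divisible by \<open>d\<close> only if it is \<open>0\<close> or \<open>d\<close>.\<close>

lemma dvd_add_iff_complementary:
  fixes d b c :: nat
  assumes "b < d" "c < d"
  shows "d dvd b + c \<longleftrightarrow> b = (if c = 0 then 0 else d - c)"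
proof
  assume "d dvd b + c"
  then obtain k where k: "b + c = d * k" by (auto simp: dvd_def)
  have "d * k < d * 2" using assms k by linarith
  then have "k = 0 \<or> k = 1" by auto
  with k assms show "b = (if c = 0 then 0 else d - c)" by auto
qed (use assms in auto)

text \<open>On the box, the bilinear form \<open>(f, g) \<mapsto> \<phi>(f g)\<close> pairs each monomial with its complement alone.\<close>

lemma eval_sum_box_neq_0_iff:
  fixes A :: "'n::finite \<Rightarrow> 'a::{field, finite} set"
  assumes A: "\<forall>i. mult_subgroup (A i)"
    and box: "b \<in> exponent_box (\<lambda>j. card (A j))" "c \<in> exponent_box (\<lambda>j. card (A j))"
  shows "eval_sum {P. \<forall>i. P i \<in> A i} (monom (b + c)) \<noteq> 0 \<longleftrightarrow>
    b = complementary_exponent (\<lambda>i. card (A i)) c"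
  using box unfolding eval_sum_monom_neq_0_iff[OF A] lookup_add poly_mapping_eq_iff fun_eq_iff
  by (simp add: dvd_add_iff_complementary exponent_box_def lookup_complementary_exponent)

text \<open>The form reads off from \<open>g\<close>, up to a nonzero factor, the coefficient at the complement of \<open>c\<close>.\<close>

lemma eval_sum_mult_monom_eq_0_iff:
  fixes A :: "'n::finite \<Rightarrow> 'a::{field, finite} set"
  assumes A: "\<forall>i. mult_subgroup (A i)"
    and g: "Poly_Mapping.keys g \<subseteq> exponent_box (\<lambda>j. card (A j))"
    and c: "c \<in> exponent_box (\<lambda>j. card (A j))"
  shows "eval_sum {P. \<forall>i. P i \<in> A i} (g * monom c) = 0 \<longleftrightarrow>
    complementary_exponent (\<lambda>i. card (A i)) c \<notin> Poly_Mapping.keys g"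
proof -
  let ?T = "{P. \<forall>i. P i \<in> A i}" and ?c' = "complementary_exponent (\<lambda>i. card (A i)) c"
  have other: "eval_sum ?T (monom (b + c)) = 0" if "b \<in> Poly_Mapping.keys g" "b \<noteq> ?c'" for b
    using eval_sum_box_neq_0_iff[OF A subsetD[OF g that(1)] c] that(2) by blast
  show ?thesis
  proof (cases "?c' \<in> Poly_Mapping.keys g")
    case True
    have "eval_sum ?T (g * monom c) = Poly_Mapping.lookup g ?c' * eval_sum ?T (monom (?c' + c))"
      unfolding eval_sum_mult_monom using other by (subst sum.remove[OF _ True]) auto
    moreover have "eval_sum ?T (monom (?c' + c)) \<noteq> 0"
      using eval_sum_box_neq_0_iff[OF A subsetD[OF g True] c] by blast
    ultimately show ?thesis using True by (simp add: in_keys_iff)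
  next
    case False
    then have "eval_sum ?T (g * monom c) = 0"
      unfolding eval_sum_mult_monom using other by (intro sum.neutral) auto
    with False show ?thesis by simp
  qed
qed

lemma eval_sum_orthogonal_span:
  assumes "f \<in> poly_space.span M" "\<And>h. h \<in> M \<Longrightarrow> eval_sum T (g * h) = 0"
  shows "eval_sum T (g * f) = 0"
proof -
  let ?S = "{f. eval_sum T (g * f) = 0}"
  have "poly_space.subspace ?S"
  proof (rule poly_space.subspaceI)
    fix k f assume "f \<in> ?S"
    then show "scale k f \<in> ?S"
      by (simp add: eval_sum_def scale_def eval_at_mult mult.left_commute flip: sum_distrib_left)
  qed (auto simp: eval_sum_def distrib_left eval_at_add sum.distrib)
  then have "poly_space.span M \<subseteq> ?S"
    using assms(2) by (intro poly_space.span_minimal) auto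
  with assms(1) show ?thesis by blast
qed

theorem proposition7p2:
  fixes A :: "'n::finite \<Rightarrow> 'a::{field, finite} set"
    and prec :: "'n expo \<Rightarrow> 'n expo \<Rightarrow> bool"
    and L :: "('n, 'a) mpoly set"
    and k :: nat
    and a :: "nat \<Rightarrow> 'n expo"
  defines "T \<equiv> {P :: 'n \<Rightarrow> 'a. \<forall>i. P i \<in> A i}"
  defines "I \<equiv> vanishing_ideal T"
  defines "d \<equiv> (\<lambda>i. card (A i))"
  defines "\<A> \<equiv> (\<lambda>i. monom (a i)) ` {1..k}"
  defines "\<B> \<equiv> (\<lambda>i. complementary_monomial d (a i)) ` {1..k}"
  assumes "\<forall>i. mult_subgroup (A i)"
    and "graded_monomial_order prec"
    and "poly_space.subspace L"
    and "inj_on a {1..k}"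
    and "\<A> \<subseteq> standard_monomials prec I"
    and "poly_space.independent \<A>"
    and "poly_space.span \<A> = L"
  shows "algebraic_dual prec T L = poly_space.span (standard_monomials prec I - \<B>)"
proof -
  define Box where "Box = exponent_box d"
  define C where "C = (\<lambda>i. complementary_exponent d (a i)) ` {1..k}"
  note A = assms(6)
  have mo: "monomial_order prec" using assms(7) by (simp add: graded_monomial_order_def)
  \<comment> \<open>From here on everything is a statement about exponents: \<open>Box\<close> stands for the standard monomials and
    \<open>C\<close> for \<open>\<B>\<close>.\<close>
  have std: "standard_monomials prec I = monom ` Box"
    unfolding I_def T_def Box_def d_def by (rule standard_monomials_torus[OF A mo])
  have B: "\<B> = monom ` C"
    by (auto simp: \<B>_def C_def complementary_monomial_eq)
  have box: "a i \<in> Box" if "i \<in> {1..k}" for i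
  proof -
    have "(monom (a i) :: ('n, 'a) mpoly) \<in> monom ` Box" using that assms(10) std by (auto simp: \<A>_def)
    then show ?thesis by (simp add: inj_image_mem_iff[OF inj_monom])
  qed
  have diff: "monom ` Box - \<B> = monom ` (Box - C)"
    unfolding B by (simp add: image_set_diff[OF inj_monom])
  have orth: "(\<forall>f\<in>L. eval_sum T (g * f) = 0) \<longleftrightarrow> Poly_Mapping.keys g \<inter> C = {}"
    if g: "Poly_Mapping.keys g \<subseteq> Box" for g
  proof -
    have "(\<forall>f\<in>L. eval_sum T (g * f) = 0) \<longleftrightarrow> (\<forall>f\<in>\<A>. eval_sum T (g * f) = 0)"
      using assms(12) eval_sum_orthogonal_span[of _ \<A> T g] poly_space.span_base by blast
    also have "\<dots> \<longleftrightarrow> (\<forall>i\<in>{1..k}. complementary_exponent d (a i) \<notin> Poly_Mapping.keys g)"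
      using eval_sum_mult_monom_eq_0_iff[OF A] g box
      by (simp add: \<A>_def d_def T_def Box_def)
    also have "\<dots> \<longleftrightarrow> Poly_Mapping.keys g \<inter> C = {}"
      by (auto simp: C_def)
    finally show ?thesis .
  qed
  show ?thesis
    unfolding algebraic_dual_def I_def[symmetric] std diff span_monom
    by (rule set_eqI) (simp add: orth Diff_eq disjoint_eq_subset_Compl cong: conj_cong)
qed

end
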